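(* Let $(\mu,\nu)\in\mathcal{M}_+^2$. Then $\mathcal{B}(\mu,\nu)=E^=(\mu,\nu)$.
   Context: $\mathcal{M}_+(E)$ is the set of finite positive Borel measures on $E$; $\mathcal{M}_+^2=\{(\mu,\nu)\in\mathcal{M}_+(\mathbb{R})^2:\mu(\mathbb{R})=\nu(\mathbb{R})>0\}$. $F_\gamma^+(t)=\gamma((-\infty,t])$, $F_\gamma^-(t)=\gamma((-\infty,t))$. A set $\Gamma\subset\mathbb{R}^2$ is cyclically monotone if for all $n\ge1$ and $(x_1,y_1),\dots,(x_n,y_n)\in\Gamma$, $\sum_{i=1}^n|y_i-x_i|\le\sum_{i=1}^n|y_{i+1}-x_i|$ ($y_{n+1}=y_1$). $\mathfrak{C}(\mu,\nu)$ is the set of $\pi\in\mathcal{M}_+(\mathbb{R}^2)$ with marginals $\mu,\nu$ that are concentrated on a cyclically monotone set. For $x\in\mathbb{R}$ let $\mathrm C(x)=(]-\infty,x[\,\times\,]x,+\infty[)\cup(]x,+\infty[\,\times\,]-\infty,x[)$. The set of barrier points is $\mathcal{B}(\mu,\nu)=\{x\in\mathbb{R}:\pi(\mathrm C(x))=0\text{ for all }\pi\in\mathfrak{C}(\mu,\nu)\}$. $E^+=\{x:F_\mu^+(x)>F_\nu^+(x)\text{ and }F_\mu^-(x)>F_\nu^-(x)\}$, $E^-=\{x:F_\mu^+(x)<F_\nu^+(x)\text{ and }F_\mu^-(x)<F_\nu^-(x)\}$, and $E^=(\mu,\nu)=\mathbb{R}\setminus(E^+\cup E^-)$. *)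

theory Defs
  imports "HOL-Analysis.Analysis" "HOL-Probability.Distribution_Functions"
begin

definition finite_borel_measures :: "'a::topological_space measure set" where
  "finite_borel_measures = {M. finite_measure M \<and> sets M = sets borel}"

definition equal_mass_pairs :: "(real measure \<times> real measure) set" where
  "equal_mass_pairs =
     {(\<mu>, \<nu>). \<mu> \<in> finite_borel_measures \<and> \<nu> \<in> finite_borel_measures \<and>
       measure \<mu> UNIV = measure \<nu> UNIV \<and> measure \<nu> UNIV > 0}"

text \<open>The right-continuous distribution function \<open>F\<^sup>+\<close> is the library's \<^const>\<open>cdf\<close>;
  this is its left-continuous counterpart \<open>F\<^sup>-\<close>.\<close>

definition cdf_left :: "real measure \<Rightarrow> real \<Rightarrow> real" where
  "cdf_left M t = measure M {..<t}"

definition cyclically_monotone :: "(real \<times> real) set \<Rightarrow> bool" where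
  "cyclically_monotone \<Gamma> \<longleftrightarrow>
     (\<forall>n\<ge>1. \<forall>x y :: nat \<Rightarrow> real. (\<forall>i\<in>{1..n}. (x i, y i) \<in> \<Gamma>) \<longrightarrow>
       (\<Sum>i=1..n. \<bar>y i - x i\<bar>) \<le> (\<Sum>i=1..n. \<bar>y (if i = n then 1 else i + 1) - x i\<bar>))"

text \<open>The set \<open>\<Gamma>\<close> is not required to be Borel: being concentrated on it means that its complement
  is contained in a null set. As subsets of cyclically monotone sets are cyclically monotone,
  requiring \<open>\<Gamma>\<close> to be Borel would give the same couplings.\<close>

definition cm_couplings :: "real measure \<Rightarrow> real measure \<Rightarrow> (real \<times> real) measure set" where
  "cm_couplings \<mu> \<nu> =
     {\<pi> \<in> finite_borel_measures. distr \<pi> borel fst = \<mu> \<and> distr \<pi> borel snd = \<nu> \<and>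
       (\<exists>\<Gamma>. cyclically_monotone \<Gamma> \<and> (AE p in \<pi>. p \<in> \<Gamma>))}"

definition crossing :: "real \<Rightarrow> (real \<times> real) set" where
  "crossing x = {..<x} \<times> {x<..} \<union> {x<..} \<times> {..<x}"

definition barrier_points :: "real measure \<Rightarrow> real measure \<Rightarrow> real set" where
  "barrier_points \<mu> \<nu> = {x. \<forall>\<pi> \<in> cm_couplings \<mu> \<nu>. measure \<pi> (crossing x) = 0}"

definition E_plus :: "real measure \<Rightarrow> real measure \<Rightarrow> real set" where
  "E_plus \<mu> \<nu> = {x. cdf \<mu> x > cdf \<nu> x \<and> cdf_left \<mu> x > cdf_left \<nu> x}"

definition E_minus :: "real measure \<Rightarrow> real measure \<Rightarrow> real set" where
  "E_minus \<mu> \<nu> = {x. cdf \<mu> x < cdf \<nu> x \<and> cdf_left \<mu> x < cdf_left \<nu> x}"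

definition E_eq :: "real measure \<Rightarrow> real measure \<Rightarrow> real set" where
  "E_eq \<mu> \<nu> = UNIV - (E_plus \<mu> \<nu> \<union> E_minus \<mu> \<nu>)"

end

theory Submission
  imports Defs "HOL-Probability.Weak_Convergence"
begin

text \<open>If a cyclically monotone coupling charges the left-to-right part of \<open>crossing x\<close>, then two-cycles
  rule out any transport from right to left over \<open>x\<close>, and comparing marginals puts \<open>x\<close> in
  \<open>E_plus\<close>; the other direction gives \<open>E_minus\<close>.

  Conversely, for \<open>x\<close> in \<open>E_plus\<close> or \<open>E_minus\<close>, fix the common part of the atoms at \<open>x\<close> and couple
  the rest by quantiles; this charges \<open>crossing x\<close>. Let \<open>f\<close> have slope \<open>1\<close> where
  \<open>cdf \<nu> < cdf \<mu>\<close> and slope \<open>-1\<close> elsewhere. Every transported pair satisfies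
  \<open>\<bar>b - a\<bar> = f b - f a\<close>, so the 1-Lipschitz function \<open>f\<close> is a Kantorovich potential and the coupling is
  cyclically monotone.\<close>

section \<open>Cyclical monotonicity and Kantorovich potentials\<close>

text \<open>A cyclic shift of the \<open>y i\<close> leaves the sum of
  \<open>f (y i) - f (x i)\<close> unchanged. Before the shift this sum is the cost of the pairs;
  after it, the Lipschitz bound makes it at most the shifted cost.\<close>

lemma cyclically_monotone_potential:
  fixes f :: "real \<Rightarrow> real"
  assumes "\<And>a b. \<bar>f b - f a\<bar> \<le> \<bar>b - a\<bar>"
  shows "cyclically_monotone {(a, b). \<bar>b - a\<bar> = f b - f a}"
  unfolding cyclically_monotone_def
proof (intro allI impI)
  fix n :: nat and x y :: "nat \<Rightarrow> real"
  assume n: "1 \<le> n" and xy: "\<forall>i\<in>{1..n}. (x i, y i) \<in> {(a, b). \<bar>b - a\<bar> = f b - f a}"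
  let ?s = "\<lambda>i. if i = n then 1 else i + 1"
  have "bij_betw ?s {1..n} {1..n}"
    by (rule bij_betw_byWitness[where f' = "\<lambda>i. if i = 1 then n else i - 1"]) (use n in auto)
  then have shift: "(\<Sum>i=1..n. f (y (?s i))) = (\<Sum>i=1..n. f (y i))"
    by (rule sum.reindex_bij_betw)
  have "(\<Sum>i=1..n. \<bar>y i - x i\<bar>) = (\<Sum>i=1..n. f (y i) - f (x i))"
    using xy by (intro sum.cong) auto
  also have "\<dots> = (\<Sum>i=1..n. f (y (?s i)) - f (x i))"
    by (simp only: sum_subtractf shift)
  also have "\<dots> \<le> (\<Sum>i=1..n. \<bar>y (?s i) - x i\<bar>)"
    by (intro sum_mono order_trans[OF abs_ge_self assms])
  finally show "(\<Sum>i=1..n. \<bar>y i - x i\<bar>) \<le> (\<Sum>i=1..n. \<bar>y (?s i) - x i\<bar>)" .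
qed

text \<open>This instance is all that the inclusion of \<open>E_eq\<close> in
  \<open>barrier_points\<close> takes from cyclical monotonicity.\<close>

lemma cyclically_monotone_two_cycle:
  assumes "cyclically_monotone \<Gamma>" "(a, b) \<in> \<Gamma>" "(a', b') \<in> \<Gamma>"
  shows "\<bar>b - a\<bar> + \<bar>b' - a'\<bar> \<le> \<bar>b' - a\<bar> + \<bar>b - a'\<bar>"
proof -
  let ?x = "\<lambda>i::nat. if i = 1 then a else a'" and ?y = "\<lambda>i::nat. if i = 1 then b else b'"
  have "(\<Sum>i=1..2. \<bar>?y i - ?x i\<bar>) \<le> (\<Sum>i=1..2. \<bar>?y (if i = 2 then 1 else i + 1) - ?x i\<bar>)"
    using assms(1)[unfolded cyclically_monotone_def, rule_format, of 2 ?x ?y] assms(2,3) by simp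
  moreover have "{1..2::nat} = {1, 2}" by auto
  ultimately show ?thesis by simp
qed

text \<open>Take a primitive of the function that is 1 on \<open>D\<close> and -1 off
  \<open>D\<close>. Endpoints are null, so only open intervals have to be tested against
  \<open>D\<close>.\<close>

lemma sign_potential_exists:
  fixes D :: "real set"
  assumes [measurable]: "D \<in> sets borel"
  obtains f :: "real \<Rightarrow> real" where
    "\<And>a b. \<bar>f b - f a\<bar> \<le> \<bar>b - a\<bar>"
    "\<And>a b. a \<le> b \<Longrightarrow> {a<..<b} \<subseteq> D \<Longrightarrow> f b - f a = b - a"
    "\<And>a b. a \<le> b \<Longrightarrow> {a<..<b} \<inter> D = {} \<Longrightarrow> f b - f a = a - b"
proof -
  define s :: "real \<Rightarrow> real" where "s t = (if t \<in> D then 1 else -1)" for t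
  have [measurable]: "s \<in> borel_measurable borel" unfolding s_def by measurable
  define f :: "real \<Rightarrow> real" where "f t = (LBINT u=0..t. s u)" for t
  have int: "interval_lebesgue_integrable lborel (ereal a) (ereal b) s" for a b :: real
  proof -
    have "set_integrable lborel {min a b..max a b} s"
      unfolding set_integrable_def
      by (rule integrableI_bounded_set[where A = "{min a b..max a b}" and B = 1])
         (auto simp: s_def indicator_def)
    then show ?thesis
      by (auto simp: interval_lebesgue_integrable_def einterval_eq min_def max_def
          intro: set_integrable_subset split: if_splits)
  qed
  have diff: "f b - f a = (LBINT u=a..b. s u)" for a b
  proof -
    \<comment> \<open>Additivity over oriented intervals asks for integrability on the hull of the
      three endpoints, in whatever order they lie.\<close>
    have "interval_lebesgue_integrable lborel (min (ereal 0) (min (ereal a) (ereal b)))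
        (max (ereal 0) (max (ereal a) (ereal b))) s"
      by (simp add: int flip: ereal_min ereal_max)
    from interval_integral_sum[OF this] show ?thesis unfolding f_def by (simp add: zero_ereal_def)
  qed
  have lip: "\<bar>f b - f a\<bar> \<le> b - a" if "a \<le> b" for a b
  proof -
    have "\<bar>LBINT u=a..b. s u\<bar> \<le> \<bar>LBINT u=a..b. (1::real)\<bar>"
      using interval_integral_norm2[OF int[of a b]]
      by (simp add: s_def[abs_def] if_distrib cong: if_cong)
    then show ?thesis using that unfolding diff by simp
  qed
  show thesis
  proof
    show "\<bar>f b - f a\<bar> \<le> \<bar>b - a\<bar>" for a b
      using lip[of a b] lip[of b a] by linarith
    show "f b - f a = b - a" if "a \<le> b" "{a<..<b} \<subseteq> D" for a b
    proof -
      have "(LBINT u=a..b. s u) = (LBINT u=a..b. 1)"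
        by (rule interval_integral_cong)
          (use that in \<open>auto simp: s_def einterval_eq min_def max_def subset_iff split: if_splits\<close>)
      then show ?thesis unfolding diff by simp
    qed
    show "f b - f a = a - b" if "a \<le> b" "{a<..<b} \<inter> D = {}" for a b
    proof -
      have "(LBINT u=a..b. s u) = (LBINT u=a..b. -1)"
        by (rule interval_integral_cong)
          (use that in \<open>auto simp: s_def einterval_eq min_def max_def disjoint_iff split: if_splits\<close>)
      then show ?thesis unfolding diff by simp
    qed
  qed
qed

section \<open>Distribution functions and quantiles with a split atom\<close>

lemma cdf_eq_cdf_left:
  assumes "finite_borel_measure \<mu>"
  shows "cdf \<mu> x = cdf_left \<mu> x + measure \<mu> {x}"
proof -
  interpret finite_borel_measure \<mu> by fact
  have "{..x} = {..<x} \<union> {x}" by auto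
  then show ?thesis
    using finite_measure_Union[of "{..<x}" "{x}"] by (simp add: cdf_def cdf_left_def sets_M)
qed

lemma cdf_le_cdf_left:
  assumes "finite_borel_measure \<mu>" "t < x"
  shows "cdf \<mu> t \<le> cdf_left \<mu> x"
proof -
  interpret finite_borel_measure \<mu> by fact
  show ?thesis unfolding cdf_def cdf_left_def
    using assms(2) by (intro finite_measure_mono) (auto simp: sets_M)
qed

text \<open>Mass \<open>c\<close> of the atom at \<open>x\<close> is parked on the last stretch of
  \<open>{0<..<m}\<close>; before it, \<open>X\<close> is the quantile function of \<mu> minus
  \<open>c\<close> times the Dirac mass at \<open>x\<close>. Two measures of equal mass treated with
  the same \<open>c\<close> then share the stretch on which nothing moves.\<close>

lemma split_quantile_exists:
  assumes "finite_borel_measure \<mu>" "0 \<le> c" "c \<le> measure \<mu> {x}"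
  defines "m \<equiv> measure \<mu> UNIV"
  obtains X where "X \<in> borel_measurable (restrict_space lborel {0<..<m})"
    "distr (restrict_space lborel {0<..<m}) borel X = \<mu>"
    "\<And>u t. u \<in> {0<..<m - c} \<Longrightarrow> X u \<le> t \<longleftrightarrow> u \<le> cdf \<mu> t - c * indicator {x..} t"
    "\<And>u. u \<in> {m - c..<m} \<Longrightarrow> X u = x"
proof -
  interpret finite_borel_measure \<mu> by fact
  define F where "F t = cdf \<mu> t - c * indicator {x..} t" for t
  have m: "measure \<mu> (space \<mu>) = m" by (simp add: m_def borel_UNIV)
  have mono_F: "mono F"
  proof (rule monoI)
    fix s t :: real assume "s \<le> t"
    \<comment> \<open>The jump of \<open>cdf \<mu>\<close> at \<open>x\<close> is the mass of the
      atom, so lowering it by \<open>c\<close> keeps \<open>F\<close> monotone.\<close>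
    moreover have "cdf \<mu> s + c \<le> cdf \<mu> t" if "s < x" "x \<le> t"
      using cdf_le_cdf_left[OF assms(1) that(1)] cdf_eq_cdf_left[OF assms(1), of x]
        cdf_nondecreasing[OF that(2)] assms(3) by linarith
    ultimately show "F s \<le> F t"
      using cdf_nondecreasing[of s t] by (auto simp: F_def indicator_def)
  qed
  have "continuous (at_right t) (indicator {x..} :: real \<Rightarrow> real)" for t
  proof (cases "t < x")
    case True
    then have "eventually (\<lambda>s. indicator {x..} s = (0::real)) (at_right t)"
      by (auto simp: eventually_at_right indicator_def intro!: exI[of _ x])
    then show ?thesis using True by (auto simp: continuous_within intro: tendsto_eventually)
  next
    case False
    then have "eventually (\<lambda>s. indicator {x..} s = (1::real)) (at_right t)"
      by (auto intro: eventually_mono[OF eventually_at_right_less[of t]])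
    then show ?thesis using False by (auto simp: continuous_within intro: tendsto_eventually)
  qed
  then have cont_F: "continuous (at_right t) F" for t
    unfolding F_def by (intro continuous_intros cdf_is_right_cont)
  have "eventually (\<lambda>t. cdf \<mu> t = F t) at_bot"
    unfolding eventually_at_bot_linorder by (auto simp: F_def indicator_def intro!: exI[of _ "x - 1"])
  then have bot_F: "(F \<longlongrightarrow> 0) at_bot"
    by (rule Lim_transform_eventually[OF cdf_lim_at_bot])
  have "eventually (\<lambda>t. cdf \<mu> t - c = F t) at_top"
    unfolding eventually_at_top_linorder by (auto simp: F_def indicator_def intro!: exI[of _ x])
  then have top_F: "(F \<longlongrightarrow> m - c) at_top"
    using Lim_transform_eventually tendsto_diff[OF cdf_lim_at_top tendsto_const[of c]] m by metis
  interpret F: right_continuous_mono F 0 "m - c"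
    by standard (fact cont_F mono_F bot_F top_F)+
  have F_nonneg: "0 \<le> F t" for t
  proof (rule tendsto_upperbound[OF bot_F])
    show "eventually (\<lambda>s. F s \<le> F t) at_bot"
      unfolding eventually_at_bot_linorder using mono_F by (auto dest: monoD)
  qed simp
  have F_le: "F t \<le> m - c" for t
  proof (rule tendsto_lowerbound[OF top_F])
    show "eventually (\<lambda>s. F t \<le> F s) at_top"
      unfolding eventually_at_top_linorder using mono_F by (auto dest: monoD)
  qed simp
  have c_le: "c \<le> m"
    using assms(3) bounded_measure[of "{x}"] m by linarith
  let ?\<Omega> = "restrict_space lborel {0<..<m}"
  \<comment> \<open>\<open>F.I\<close> is the generalized inverse of \<open>F\<close>, and its
    \<open>pseudoinverse\<close> rule holds only strictly below \<open>m - c\<close>; hence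
    \<open>u = m - c\<close> goes to the constant branch.\<close>
  define X where "X u = (if u < m - c then F.I u else x)" for u
  have le_iff: "X u \<le> t \<longleftrightarrow> (if u < m - c then u \<le> F t else x \<le> t)" if "0 < u" for u t
    using F.pseudoinverse[of u t] that by (simp add: X_def)
  \<comment> \<open>The second factor \<open>{0<..}\<close> matters when \<open>c = m\<close>, where
    the constant stretch would otherwise include 0.\<close>
  have level: "{u \<in> {0<..<m}. X u \<le> t} =
      ({0<..<m - c} \<inter> {..F t}) \<union> (if x \<le> t then {m - c..<m} \<inter> {0<..} else {})" for t
    using assms(2) by (auto simp: le_iff split: if_splits)
  have "{u \<in> {0<..<m}. X u \<le> t} \<in> sets borel" for t
    unfolding level by auto
  then have X [measurable]: "X \<in> borel_measurable ?\<Omega>"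
    by (auto simp: borel_measurable_iff_le space_restrict_space sets_restrict_space_iff)
  have "distr ?\<Omega> borel X = \<mu>"
  proof (rule cdf_unique')
    interpret \<Omega>: finite_measure ?\<Omega>
      by (rule finite_measureI) (simp add: m_def emeasure_restrict_space space_restrict_space)
    show "finite_borel_measure (distr ?\<Omega> borel X)"
      by (simp add: finite_borel_measure_def finite_borel_measure_axioms_def \<Omega>.finite_measure_distr)
    show "cdf (distr ?\<Omega> borel X) = cdf \<mu>"
    proof
      fix t
      have "cdf (distr ?\<Omega> borel X) t = measure ?\<Omega> {u \<in> {0<..<m}. X u \<le> t}"
        unfolding cdf_def
        by (subst measure_distr) (auto simp: space_restrict_space intro!: arg_cong2[where f = measure])
      also have "\<dots> = measure lborel {u \<in> {0<..<m}. X u \<le> t}"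
        by (rule measure_restrict_space) auto
      \<comment> \<open>The two sets differ at most in the points 0 and \<open>F t\<close>. The new
        lengths add up to \<open>F t + c * indicator {x..} t\<close>, which is
        \<open>cdf \<mu> t\<close>.\<close>
      also have "\<dots> = measure lborel ({0<..<F t} \<union> (if x \<le> t then {m - c..<m} else {}))"
        unfolding level measure_def
      proof (intro arg_cong[where f = enn2real] emeasure_eq_AE)
        show "AE u in lborel.
          (u \<in> {0<..<m - c} \<inter> {..F t} \<union> (if x \<le> t then {m - c..<m} \<inter> {0<..} else {})) =
          (u \<in> {0<..<F t} \<union> (if x \<le> t then {m - c..<m} else {}))"
          using AE_lborel_singleton[of "0::real"] AE_lborel_singleton[of "F t"]
          by eventually_elim (use F_le[of t] c_le in auto)
      qed auto
      also have "\<dots> = measure lborel {0<..<F t} + measure lborel (if x \<le> t then {m - c..<m} else {})"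
      proof (rule measure_Union)
        show "{0<..<F t} \<inter> (if x \<le> t then {m - c..<m} else {}) = {}"
          using F_le[of t] by auto
      qed (use F_nonneg[of t] assms(2) in auto)
      also have "\<dots> = cdf \<mu> t"
        using F_nonneg[of t] assms(2) by (auto simp: F_def indicator_def)
      finally show "cdf (distr ?\<Omega> borel X) t = cdf \<mu> t" .
    qed
  qed (fact assms(1))
  with X show thesis
  proof (rule that)
    show "X u \<le> t \<longleftrightarrow> u \<le> cdf \<mu> t - c * indicator {x..} t" if "u \<in> {0<..<m - c}" for u t
      using le_iff[of u t] that unfolding F_def by simp
  qed (simp add: X_def)
qed

text \<open>Removing \<open>c\<close> leaves an atom at \<open>x\<close> in at most one of the
  measures. Levels above \<open>cdf \<nu> x - c\<close> send \<open>Y\<close> beyond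
  \<open>x\<close>, and levels below \<open>cdf_left \<mu> x\<close> leave \<open>X\<close> before
  \<open>x\<close>. The first bound lies below the second: by the inequality for
  \<open>cdf_left\<close> if \<open>c\<close> is the atom of \<nu>, by that for \<open>cdf\<close>
  if it is the atom of \<mu>.\<close>

lemma split_quantiles_cross:
  fixes x :: real and X Y :: "real \<Rightarrow> real"
  assumes "finite_borel_measure \<mu>" "finite_borel_measure \<nu>"
  defines "c \<equiv> min (measure \<mu> {x}) (measure \<nu> {x})" and "m \<equiv> measure \<mu> UNIV"
  assumes "cdf_left \<nu> x < cdf_left \<mu> x" "cdf \<nu> x < cdf \<mu> x"
  assumes X: "\<And>u t. u \<in> {0<..<m - c} \<Longrightarrow> X u \<le> t \<longleftrightarrow> u \<le> cdf \<mu> t - c * indicator {x..} t"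
  assumes Y: "\<And>u t. u \<in> {0<..<m - c} \<Longrightarrow> Y u \<le> t \<longleftrightarrow> u \<le> cdf \<nu> t - c * indicator {x..} t"
  obtains p q where "p < q" "{p<..<q} \<subseteq> {u \<in> {0<..<m}. X u < x \<and> x < Y u}"
proof -
  interpret finite_borel_measure \<mu> by fact
  define p where "p = cdf \<nu> x - c"
  have "p < cdf_left \<mu> x"
    using cdf_eq_cdf_left[OF assms(1), of x] cdf_eq_cdf_left[OF assms(2), of x] assms(5,6)
    unfolding p_def c_def by linarith
  \<comment> \<open>To get \<open>X u < x\<close> strictly from a rule about
    \<open>X u \<le> t\<close>, a \<open>t\<close> left of \<open>x\<close> is needed at which
    \<open>cdf \<mu>\<close> already exceeds \<open>p\<close>.\<close>
  then have "eventually (\<lambda>t. p < cdf \<mu> t) (at_left x)"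
    using order_tendstoD(1)[OF cdf_at_left[of x]] by (simp add: cdf_left_def)
  then have "eventually (\<lambda>t. p < cdf \<mu> t \<and> t < x) (at_left x)"
    by (auto elim!: eventually_mono simp: eventually_at_filter)
  then obtain t where t: "p < cdf \<mu> t" "t < x"
    using eventually_happens'[OF trivial_limit_at_left_real] by blast
  have "0 \<le> p"
    using cdf_eq_cdf_left[OF assms(2), of x] unfolding p_def c_def
    by (simp add: cdf_left_def min_def measure_nonneg add_increasing)
  have "cdf \<mu> t \<le> cdf \<mu> x - c"
    using cdf_le_cdf_left[OF assms(1) t(2)] cdf_eq_cdf_left[OF assms(1), of x] unfolding c_def by linarith
  also have "\<dots> \<le> m - c"
    using cdf_bounded[of x] by (simp add: m_def borel_UNIV)
  finally have "cdf \<mu> t \<le> m - c" .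
  moreover have "0 \<le> c" by (simp add: c_def)
  moreover have "X u < x \<and> x < Y u" if "u \<in> {p<..<cdf \<mu> t}" for u
    using X[of u t] Y[of u x] that t \<open>0 \<le> p\<close> \<open>cdf \<mu> t \<le> m - c\<close>
    by (auto simp: p_def not_le[symmetric])
  ultimately show thesis
    using t(1) \<open>0 \<le> p\<close> by (intro that[of p "cdf \<mu> t"]) auto
qed

section \<open>A cyclically monotone coupling that charges the crossing set\<close>

text \<open>The quantile coupling of \<open>\<mu>\<close> and \<open>\<nu>\<close> itself may avoid \<open>crossing x\<close> by passing through atoms
  at \<open>x\<close>. Leaving the common part of these atoms in place cures this.\<close>

lemma crossing_coupling_exists:
  assumes fin: "finite_borel_measure \<mu>" "finite_borel_measure \<nu>"
    and mass: "measure \<mu> UNIV = measure \<nu> UNIV"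
    and "x \<notin> E_eq \<mu> \<nu>"
  shows "\<exists>\<pi>\<in>cm_couplings \<mu> \<nu>. measure \<pi> (crossing x) > 0"
proof -
  define m where "m = measure \<mu> UNIV"
  define c where "c = min (measure \<mu> {x}) (measure \<nu> {x})"
  have m': "m = measure \<nu> UNIV" using mass by (simp add: m_def)
  have c': "c = min (measure \<nu> {x}) (measure \<mu> {x})" by (simp add: c_def min.commute)
  have c: "0 \<le> c" "c \<le> measure \<mu> {x}" "c \<le> measure \<nu> {x}" by (auto simp: c_def)
  let ?\<Omega> = "restrict_space lborel {0<..<m}"
  interpret \<Omega>: finite_measure ?\<Omega>
    by (rule finite_measureI) (simp add: m_def emeasure_restrict_space space_restrict_space)
  obtain X where X [measurable]: "X \<in> borel_measurable ?\<Omega>" and "distr ?\<Omega> borel X = \<mu>"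
    and X_le: "\<And>u t. u \<in> {0<..<m - c} \<Longrightarrow> X u \<le> t \<longleftrightarrow> u \<le> cdf \<mu> t - c * indicator {x..} t"
    and X_eq: "\<And>u. u \<in> {m - c..<m} \<Longrightarrow> X u = x"
    using split_quantile_exists[OF fin(1) c(1,2)] unfolding m_def by blast
  obtain Y where Y [measurable]: "Y \<in> borel_measurable ?\<Omega>" and "distr ?\<Omega> borel Y = \<nu>"
    and Y_le: "\<And>u t. u \<in> {0<..<m - c} \<Longrightarrow> Y u \<le> t \<longleftrightarrow> u \<le> cdf \<nu> t - c * indicator {x..} t"
    and Y_eq: "\<And>u. u \<in> {m - c..<m} \<Longrightarrow> Y u = x"
    using split_quantile_exists[OF fin(2) c(1,3)] unfolding m' by blast
  define D where "D = {t. cdf \<nu> t < cdf \<mu> t}"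
  have [measurable]: "cdf \<mu> \<in> borel_measurable borel" "cdf \<nu> \<in> borel_measurable borel"
    using fin by (auto intro!: borel_measurable_mono monoI finite_borel_measure.cdf_nondecreasing)
  have "D \<in> sets borel" unfolding D_def by measurable
  then obtain f :: "real \<Rightarrow> real" where lip: "\<And>a b. \<bar>f b - f a\<bar> \<le> \<bar>b - a\<bar>"
    and up: "\<And>a b. a \<le> b \<Longrightarrow> {a<..<b} \<subseteq> D \<Longrightarrow> f b - f a = b - a"
    and down: "\<And>a b. a \<le> b \<Longrightarrow> {a<..<b} \<inter> D = {} \<Longrightarrow> f b - f a = a - b"
    using sign_potential_exists by blast
  define \<Gamma> where "\<Gamma> = {(a, b). \<bar>b - a\<bar> = f b - f a}"
  have "1-lipschitz_on UNIV f"
    using lip by (intro lipschitz_onI) (auto simp: dist_real_def)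
  then have [measurable]: "f \<in> borel_measurable borel"
    by (intro borel_measurable_continuous_onI lipschitz_on_continuous_on)
  have in_\<Gamma>: "(X u, Y u) \<in> \<Gamma>" if u: "u \<in> {0<..<m}" for u
  proof (cases "u < m - c")
    case True
    then have u': "u \<in> {0<..<m - c}" using u by simp
    show ?thesis
    proof (cases "X u \<le> Y u")
      case True
      \<comment> \<open>For \<open>t\<close> in between, \<open>u\<close> is at most the reduced
        \<open>cdf \<mu> t\<close> and above the reduced \<open>cdf \<nu> t\<close>; the correction
        by \<open>c\<close> is the same in both and cancels.\<close>
      have "{X u<..<Y u} \<subseteq> D"
        using X_le[OF u'] Y_le[OF u'] unfolding D_def
        by (smt (verit) greaterThanLessThan_iff mem_Collect_eq subsetI)
      from up[OF True this] True show ?thesis by (simp add: \<Gamma>_def)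
    next
      case False
      have "{Y u<..<X u} \<inter> D = {}"
        using X_le[OF u'] Y_le[OF u'] unfolding D_def disjoint_iff
        by (smt (verit) greaterThanLessThan_iff mem_Collect_eq)
      from down[OF _ this] False show ?thesis by (simp add: \<Gamma>_def)
    qed
  next
    case False
    then show ?thesis using X_eq[of u] Y_eq[of u] u by (simp add: \<Gamma>_def)
  qed
  let ?Z = "\<lambda>u. (X u, Y u)"
  have Z [measurable]: "?Z \<in> borel_measurable ?\<Omega>" by measurable
  let ?\<pi> = "distr ?\<Omega> borel ?Z"
  have "Measurable.pred borel (\<lambda>p::real \<times> real. p \<in> \<Gamma>)"
    unfolding \<Gamma>_def case_prod_beta mem_Collect_eq borel_prod[symmetric] by measurable
  then have "\<Gamma> \<in> sets borel" by (simp add: pred_def)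
  then have "AE p in ?\<pi>. p \<in> \<Gamma>"
    using in_\<Gamma> by (subst AE_distr_iff) (auto simp: space_restrict_space intro!: AE_I2)
  moreover have "cyclically_monotone \<Gamma>"
    unfolding \<Gamma>_def by (rule cyclically_monotone_potential[OF lip])
  moreover have "distr ?\<pi> borel fst = \<mu>" "distr ?\<pi> borel snd = \<nu>"
    using \<open>distr ?\<Omega> borel X = \<mu>\<close> \<open>distr ?\<Omega> borel Y = \<nu>\<close>
    by (simp_all add: distr_distr comp_def borel_measurable_continuous_onI
        continuous_on_fst continuous_on_snd)
  ultimately have "?\<pi> \<in> cm_couplings \<mu> \<nu>"
    by (auto simp: cm_couplings_def finite_borel_measures_def \<Omega>.finite_measure_distr)
  moreover have "measure ?\<pi> (crossing x) > 0"
  proof -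
    have cross: "{u \<in> {0<..<m}. ?Z u \<in> crossing x} =
        {u \<in> {0<..<m}. X u < x \<and> x < Y u} \<union> {u \<in> {0<..<m}. Y u < x \<and> x < X u}"
      by (auto simp: crossing_def)
    have "x \<in> E_plus \<mu> \<nu> \<or> x \<in> E_minus \<mu> \<nu>"
      using assms(4) by (simp add: E_eq_def)
    then obtain p q where pq: "p < q" "{p<..<q} \<subseteq> {u \<in> {0<..<m}. ?Z u \<in> crossing x}"
    proof
      assume "x \<in> E_plus \<mu> \<nu>"
      then obtain p q where "p < q" "{p<..<q} \<subseteq> {u \<in> {0<..<m}. X u < x \<and> x < Y u}"
        using split_quantiles_cross[OF fin, where x = x and X = X and Y = Y,
            folded c_def m_def, OF _ _ X_le Y_le]
        unfolding E_plus_def by blast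
      then show thesis using that unfolding cross by blast
    next
      assume "x \<in> E_minus \<mu> \<nu>"
      then obtain p q where "p < q" "{p<..<q} \<subseteq> {u \<in> {0<..<m}. Y u < x \<and> x < X u}"
        \<comment> \<open>\<open>m\<close> and \<open>c\<close> are symmetric in the two measures,
          so the lemma applies with their roles exchanged.\<close>
        using split_quantiles_cross[OF fin(2,1), where x = x and X = Y and Y = X,
            folded c' m', OF _ _ Y_le X_le]
        unfolding E_minus_def by blast
      then show thesis using that unfolding cross by blast
    qed
    have open_crossing: "open (crossing x)"
      unfolding crossing_def by (intro open_Un open_Times) auto
    have "0 < measure lborel {p<..<q}" using pq(1) by simp
    also have "\<dots> = measure ?\<Omega> {p<..<q}"
      using pq(2) by (subst measure_restrict_space) auto
    also have "\<dots> \<le> measure ?\<Omega> (?Z -` crossing x \<inter> space ?\<Omega>)"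
      using pq(2) open_crossing
      by (intro \<Omega>.finite_measure_mono measurable_sets[OF Z]) (auto simp: space_restrict_space)
    also have "\<dots> = measure ?\<pi> (crossing x)"
      using open_crossing by (subst measure_distr) auto
    finally show ?thesis .
  qed
  ultimately show ?thesis by blast
qed

section \<open>Consequences of a charged crossing set\<close>

text \<open>Once mass crosses \<open>x\<close> from left to right, an opposite crossing, even one starting or ending
  at \<open>x\<close>, would violate two-cycle monotonicity.\<close>

lemma cdf_less_of_crossing:
  assumes "finite_measure M" and [measurable]: "X \<in> borel_measurable M" "Y \<in> borel_measurable M"
    and \<Gamma>: "AE \<omega> in M. (X \<omega>, Y \<omega>) \<in> \<Gamma>"
    and two: "\<And>a b a' b'. (a, b) \<in> \<Gamma> \<Longrightarrow> (a', b') \<in> \<Gamma> \<Longrightarrow>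
      \<bar>b - a\<bar> + \<bar>b' - a'\<bar> \<le> \<bar>b' - a\<bar> + \<bar>b - a'\<bar>"
    and pos: "measure M {\<omega> \<in> space M. X \<omega> < x \<and> x < Y \<omega>} > 0"
  shows "cdf (distr M borel Y) x < cdf (distr M borel X) x"
    and "cdf_left (distr M borel Y) x < cdf_left (distr M borel X) x"
proof -
  interpret finite_measure M by fact
  let ?A = "{\<omega> \<in> space M. X \<omega> < x \<and> x < Y \<omega>}"
  obtain a b where ab: "(a, b) \<in> \<Gamma>" "a < x" "x < b"
  proof (rule ccontr)
    assume "\<not> thesis"
    with that have "AE \<omega> in M. \<omega> \<notin> ?A" using \<Gamma> by (auto elim!: eventually_mono)
    then have "?A \<in> null_sets M" by (simp add: AE_iff_null_sets)
    with pos show False by (simp add: measure_eq_0_null_sets)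
  qed
  \<comment> \<open>Otherwise the segments from \<open>a\<close> to \<open>b\<close> and from
    \<open>b'\<close> to \<open>a'\<close> overlap in positive length, and exchanging targets saves
    twice that length.\<close>
  have no_left: "\<not> (b' < x \<and> x \<le> a' \<or> b' \<le> x \<and> x < a')" if "(a', b') \<in> \<Gamma>" for a' b'
    using two[OF ab(1) that] ab(2,3) by linarith
  \<comment> \<open>By \<open>no_left\<close>, almost surely \<open>Y \<le> x\<close> forces
    \<open>X \<le> x\<close>, while on \<open>?A\<close> one has \<open>Y > x\<close>. Hence the
    mass of \<open>?A\<close> is a gap between the two distribution functions; the strict version
    below works alike.\<close>
  have "measure M {\<omega> \<in> space M. Y \<omega> \<le> x} \<le> measure M ({\<omega> \<in> space M. X \<omega> \<le> x} - ?A)"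
    using \<Gamma> by (intro finite_measure_mono_AE) (auto elim!: eventually_mono dest: no_left)
  also have "\<dots> = measure M {\<omega> \<in> space M. X \<omega> \<le> x} - measure M ?A"
    by (rule finite_measure_Diff) auto
  finally show "cdf (distr M borel Y) x < cdf (distr M borel X) x"
    using pos by (simp add: cdf_def measure_distr vimage_def Int_def conj_commute)
  have "measure M {\<omega> \<in> space M. Y \<omega> < x} \<le> measure M ({\<omega> \<in> space M. X \<omega> < x} - ?A)"
    using \<Gamma> by (intro finite_measure_mono_AE) (auto elim!: eventually_mono dest: no_left)
  also have "\<dots> = measure M {\<omega> \<in> space M. X \<omega> < x} - measure M ?A"
    by (rule finite_measure_Diff) auto
  finally show "cdf_left (distr M borel Y) x < cdf_left (distr M borel X) x"
    using pos by (simp add: cdf_left_def measure_distr vimage_def Int_def conj_commute)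
qed

lemma crossing_null_on_E_eq:
  assumes "\<pi> \<in> cm_couplings \<mu> \<nu>" "x \<in> E_eq \<mu> \<nu>"
  shows "measure \<pi> (crossing x) = 0"
proof (rule ccontr)
  assume nonzero: "measure \<pi> (crossing x) \<noteq> 0"
  from assms(1) obtain \<Gamma> where fin: "finite_measure \<pi>" and sets_\<pi>: "sets \<pi> = sets borel"
    and marg: "distr \<pi> borel fst = \<mu>" "distr \<pi> borel snd = \<nu>"
    and cm: "cyclically_monotone \<Gamma>" and \<Gamma>: "AE p in \<pi>. p \<in> \<Gamma>"
    by (auto simp: cm_couplings_def finite_borel_measures_def)
  interpret finite_measure \<pi> by fact
  have space_\<pi>: "space \<pi> = UNIV" using sets_eq_imp_space_eq[OF sets_\<pi>] by simp
  have meas [measurable]: "fst \<in> borel_measurable \<pi>" "snd \<in> borel_measurable \<pi>"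
    unfolding measurable_cong_sets[OF sets_\<pi> refl]
    by (auto intro!: borel_measurable_continuous_onI continuous_intros)
  note two = cyclically_monotone_two_cycle[OF cm]
  let ?R = "{p \<in> space \<pi>. fst p < x \<and> x < snd p}" and ?L = "{p \<in> space \<pi>. snd p < x \<and> x < fst p}"
  have "measure \<pi> ?R \<le> 0"
  proof (rule ccontr)
    assume "\<not> measure \<pi> ?R \<le> 0"
    then have "x \<in> E_plus \<mu> \<nu>"
      using cdf_less_of_crossing[OF fin meas, of \<Gamma> x] \<Gamma> two marg by (auto simp: E_plus_def)
    with assms(2) show False by (simp add: E_eq_def)
  qed
  moreover have "measure \<pi> ?L \<le> 0"
  proof (rule ccontr)
    assume "\<not> measure \<pi> ?L \<le> 0"
    \<comment> \<open>Exchanging the coordinates turns right-to-left transport into left-to-right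
      transport, and the two-cycle inequality survives passing to the converse relation.\<close>
    moreover have "AE p in \<pi>. (snd p, fst p) \<in> \<Gamma>\<inverse>" using \<Gamma> by simp
    moreover have "\<bar>b - a\<bar> + \<bar>b' - a'\<bar> \<le> \<bar>b' - a\<bar> + \<bar>b - a'\<bar>"
      if "(a, b) \<in> \<Gamma>\<inverse>" "(a', b') \<in> \<Gamma>\<inverse>" for a b a' b'
      using two[of b a b' a'] that by (simp add: abs_minus_commute)
    ultimately have "x \<in> E_minus \<mu> \<nu>"
      using cdf_less_of_crossing[OF fin meas(2,1), of "\<Gamma>\<inverse>" x] marg by (auto simp: E_minus_def)
    with assms(2) show False by (simp add: E_eq_def)
  qed
  moreover have "crossing x = ?R \<union> ?L" by (auto simp: crossing_def space_\<pi>)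
  moreover have "measure \<pi> (?R \<union> ?L) \<le> measure \<pi> ?R + measure \<pi> ?L"
    by (intro measure_Un_le) measurable
  ultimately show False using nonzero by (smt (verit) measure_nonneg)
qed

theorem proposition2p44:
  fixes \<mu> \<nu> :: "real measure"
  assumes "(\<mu>, \<nu>) \<in> equal_mass_pairs"
  shows "barrier_points \<mu> \<nu> = E_eq \<mu> \<nu>"
proof -
  have "finite_borel_measure \<mu>" "finite_borel_measure \<nu>" "measure \<mu> UNIV = measure \<nu> UNIV"
    using assms by (auto simp: equal_mass_pairs_def finite_borel_measures_def
        finite_borel_measure_def finite_borel_measure_axioms_def)
  note crossing_coupling = crossing_coupling_exists[OF this]
  have "x \<in> barrier_points \<mu> \<nu> \<longleftrightarrow> x \<in> E_eq \<mu> \<nu>" for x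
  proof
    assume "x \<in> barrier_points \<mu> \<nu>"
    then show "x \<in> E_eq \<mu> \<nu>"
      using crossing_coupling[of x] by (auto simp: barrier_points_def)
  next
    assume "x \<in> E_eq \<mu> \<nu>"
    then show "x \<in> barrier_points \<mu> \<nu>"
      using crossing_null_on_E_eq by (simp add: barrier_points_def)
  qed
  then show ?thesis by blast
qed

end
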